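(* Let $k\ge 3$ be an integer. The $k$-wnu identities do not imply any nontrivial SLEMC. That is, let $V_k$ be the variety of all algebras with a single $k$-ary basic operation $w$ that satisfy the identities \[ w(x,x,\dots,x)\approx x,\qquad w(y,x,x,\dots,x)\approx w(x,y,x,\dots,x)\approx\cdots\approx w(x,x,\dots,x,y). \] Then there is no nontrivial SLEMC $M$ such that $V_k$ satisfies $M$.
   Context: An algebra $\mathbf A$ is a base set $A$ together with a set of basic operations $A^n\to A$ of finite arities $n$. The clone of operations of $\mathbf A$ is the smallest set of operations on $A$ that contains all basic operations and all projections $\pi^n_i(x_1,\dots,x_n)=x_i$ and is closed under composition; its members are called the operations of $\mathbf A$. An identity $u\approx v$ holds in an algebra if the two sides are equal for every assignment of elements of the algebra to the variables. A (strong) Maltsev condition $M$ is a finite list of identities involving some operation symbols. An algebra $\mathbf A$ satisfies $M$ if to each $n$-ary operation symbol occurring in $M$ one can assign an $n$-ary operation of $\mathbf A$ (from its clone) so that all identities of $M$ become true in $\mathbf A$. A variety satisfies $M$ if all its algebras satisfy $M$. The condition $M$ is trivial if it is satisfied by the algebra $\mathbf P$ on two elements $0,1$ whose set of operations consists of the projections only; otherwise it is nontrivial. The condition $M$ is linear if its identities do not involve compositions, i.e. each identity has the form $t(\overline x)\approx s(\overline y)$, or $t(\overline x)\approx z$, or $z\approx r$, where $\overline x,\overline y$ are tuples of variables (repetitions allowed), $t,s$ are (possibly equal) operation symbols, and $z,r$ are variables. A SLEMC (single linear equality Maltsev condition) is a linear Maltsev condition consisting of exactly one identity. *)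

theory Defs
  imports Main "HOL-Library.FuncSet"
begin

text \<open>Elements of \<open>A\<^sup>n\<close> are lists of length \<open>n\<close>. An operation on \<open>A\<close> is extensional, i.e. it takes the
  value \<open>undefined\<close> outside \<open>A\<^sup>n\<close>, so that equal operations are equal as HOL functions.\<close>

definition tuples :: "'a set \<Rightarrow> nat \<Rightarrow> 'a list set" where
  "tuples A n = {xs. length xs = n \<and> set xs \<subseteq> A}"

definition operations :: "'a set \<Rightarrow> nat \<Rightarrow> ('a list \<Rightarrow> 'a) set" where
  "operations A n = tuples A n \<rightarrow>\<^sub>E A"

definition projection :: "'a set \<Rightarrow> nat \<Rightarrow> nat \<Rightarrow> 'a list \<Rightarrow> 'a" where
  "projection A n i = (\<lambda>xs\<in>tuples A n. xs ! i)"

definition compose_op :: "'a set \<Rightarrow> nat \<Rightarrow> ('a list \<Rightarrow> 'a) \<Rightarrow> ('a list \<Rightarrow> 'a) list \<Rightarrow> 'a list \<Rightarrow> 'a" where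
  "compose_op A n f gs = (\<lambda>xs\<in>tuples A n. f (map (\<lambda>g. g xs) gs))"

text \<open>A basic operation is stored together with its arity, which the function alone does not
  determine.\<close>

record 'a algebra =
  base :: "'a set"
  basic_ops :: "(nat \<times> ('a list \<Rightarrow> 'a)) set"

definition is_algebra :: "'a algebra \<Rightarrow> bool" where
  "is_algebra \<A> \<longleftrightarrow> base \<A> \<noteq> {} \<and> (\<forall>(n, f) \<in> basic_ops \<A>. f \<in> operations (base \<A>) n)"

inductive_set clone :: "'a algebra \<Rightarrow> (nat \<times> ('a list \<Rightarrow> 'a)) set" for \<A> :: "'a algebra" where
  basic: "(n, f) \<in> basic_ops \<A> \<Longrightarrow> (n, f) \<in> clone \<A>"
| proj: "i < n \<Longrightarrow> (n, projection (base \<A>) n i) \<in> clone \<A>"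
| comp: "(m, f) \<in> clone \<A> \<Longrightarrow> length gs = m \<Longrightarrow> \<forall>g\<in>set gs. (n, g) \<in> clone \<A> \<Longrightarrow>
    (n, compose_op (base \<A>) n f gs) \<in> clone \<A>"

datatype op_symbol = Op_Symbol (symbol_name: nat) (arity: nat)

datatype tm = Var nat | App op_symbol "tm list"

type_synonym identity = "tm \<times> tm"

fun wf_tm :: "tm \<Rightarrow> bool" where
  "wf_tm (Var x) \<longleftrightarrow> True"
| "wf_tm (App f ts) \<longleftrightarrow> length ts = arity f \<and> (\<forall>t\<in>set ts. wf_tm t)"

fun symbols :: "tm \<Rightarrow> op_symbol set" where
  "symbols (Var x) = {}"
| "symbols (App f ts) = insert f (\<Union>t\<in>set ts. symbols t)"

fun eval_tm :: "(op_symbol \<Rightarrow> 'a list \<Rightarrow> 'a) \<Rightarrow> (nat \<Rightarrow> 'a) \<Rightarrow> tm \<Rightarrow> 'a" where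
  "eval_tm I v (Var x) = v x"
| "eval_tm I v (App f ts) = I f (map (eval_tm I v) ts)"

definition holds :: "'a set \<Rightarrow> (op_symbol \<Rightarrow> 'a list \<Rightarrow> 'a) \<Rightarrow> identity \<Rightarrow> bool" where
  "holds A I e \<longleftrightarrow> (\<forall>v. range v \<subseteq> A \<longrightarrow> eval_tm I v (fst e) = eval_tm I v (snd e))"

definition maltsev_condition :: "identity list \<Rightarrow> bool" where
  "maltsev_condition M \<longleftrightarrow> (\<forall>(s, t) \<in> set M. wf_tm s \<and> wf_tm t)"

definition condition_symbols :: "identity list \<Rightarrow> op_symbol set" where
  "condition_symbols M = (\<Union>(s, t) \<in> set M. symbols s \<union> symbols t)"

definition satisfies :: "'a algebra \<Rightarrow> identity list \<Rightarrow> bool" where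
  "satisfies \<A> M \<longleftrightarrow> (\<exists>I. (\<forall>f \<in> condition_symbols M. (arity f, I f) \<in> clone \<A>) \<and>
    (\<forall>e \<in> set M. holds (base \<A>) I e))"

definition class_satisfies :: "'a algebra set \<Rightarrow> identity list \<Rightarrow> bool" where
  "class_satisfies V M \<longleftrightarrow> (\<forall>\<A> \<in> V. satisfies \<A> M)"

definition projection_algebra :: "nat algebra" where
  "projection_algebra = \<lparr>base = {0, 1}, basic_ops = {(n, projection {0, 1} n i) | n i. i < n}\<rparr>"

definition trivial_condition :: "identity list \<Rightarrow> bool" where
  "trivial_condition M \<longleftrightarrow> satisfies projection_algebra M"

fun linear_tm :: "tm \<Rightarrow> bool" where
  "linear_tm (Var x) \<longleftrightarrow> True"
| "linear_tm (App f ts) \<longleftrightarrow> set ts \<subseteq> range Var"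

definition linear_condition :: "identity list \<Rightarrow> bool" where
  "linear_condition M \<longleftrightarrow> (\<forall>(s, t) \<in> set M. linear_tm s \<and> linear_tm t)"

definition slemc :: "identity list \<Rightarrow> bool" where
  "slemc M \<longleftrightarrow> maltsev_condition M \<and> linear_condition M \<and> length M = 1"

text \<open>With \<open>x\<close> as \<open>Var 0\<close> and \<open>y\<close> as \<open>Var 1\<close>: idempotence, followed by the consecutive links of
  \<open>w(y,x,\<dots>,x) \<approx> w(x,y,x,\<dots>,x) \<approx> \<dots> \<approx> w(x,\<dots>,x,y)\<close>.\<close>

definition wnu_identities :: "op_symbol \<Rightarrow> identity list" where
  "wnu_identities w = (let k = arity w; one_y = (\<lambda>i. (replicate k (Var 0))[i := Var 1]) in
     (App w (replicate k (Var 0)), Var 0) #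
     map (\<lambda>i. (App w (one_y i), App w (one_y (Suc i)))) [0..<k - 1])"

text \<open>The members of the variety whose base set is a subset of the type \<open>'a\<close>. The operation symbol
  is always interpreted as the single basic operation, so its name is irrelevant. Since HOL cannot
  quantify over types inside a formula, the universe \<open>'a\<close> is a parameter; any infinite \<open>'a\<close> decides
  which conditions hold in the whole variety, as the free algebra on countably many generators is
  countable.\<close>

definition wnu_variety :: "nat \<Rightarrow> 'a algebra set" where
  "wnu_variety k = {\<A>. is_algebra \<A> \<and> (\<exists>w. basic_ops \<A> = {(k, w)} \<and>
     (\<forall>e \<in> set (wnu_identities (Op_Symbol 0 k)). holds (base \<A>) (\<lambda>_. w) e))}"

end

theory Submission
  imports Defs "HOL-Library.Countable"
begin

text \<open>A single linear identity is trivial unless its sides share no variable, which idempotence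
  rules out, or it has the form \<open>t(x\<^sub>1,\<dots>,x\<^sub>n) \<approx> t(y\<^sub>1,\<dots>,y\<^sub>n)\<close> with \<open>x\<^sub>i \<noteq> y\<^sub>i\<close> for all \<open>i\<close>. The
  latter fails in any algebra that carries an irreflexive relation preserved by \<open>w\<close> and containing
  all pairs of distinct members of some infinite set. In the free algebra of \<open>V\<^sub>k\<close>, whose elements
  are terms in normal form, incomparability in the subterm order is such a relation: if
  \<open>a = w(a\<^sub>1,\<dots>,a\<^sub>k)\<close> were a subterm of \<open>b = w(b\<^sub>1,\<dots>,b\<^sub>k)\<close>, then either \<open>a\<close>, and hence \<open>a\<^sub>j\<close>, is a
  subterm of some \<open>b\<^sub>j\<close>, or \<open>a = b\<close>; and two representations of one element agree in some
  coordinate, because two near-constant tuples with the same majority value do so when \<open>k \<ge> 3\<close>.\<close>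

section \<open>Terms and the subterm order\<close>

datatype wnu_term = Gen nat | Node "wnu_term list"

instance wnu_term :: countable
  by countable_datatype

primrec subterms :: "wnu_term \<Rightarrow> wnu_term set" where
  "subterms (Gen n) = {Gen n}"
| "subterms (Node ts) = insert (Node ts) (\<Union>(set (map subterms ts)))"

lemma subterms_refl [simp]: "t \<in> subterms t"
  by (cases t) auto

lemma subterms_trans: "a \<in> subterms b \<Longrightarrow> b \<in> subterms c \<Longrightarrow> a \<in> subterms c"
  by (induction c) auto

section \<open>Near-constant tuples and the operation on terms\<close>

definition spike :: "nat \<Rightarrow> 'b \<Rightarrow> 'b \<Rightarrow> nat \<Rightarrow> 'b list" where
  "spike n x y i = (replicate n x)[i := y]"

lemma length_spike [simp]: "length (spike n x y i) = n"
  by (simp add: spike_def)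

lemma nth_spike: "j < n \<Longrightarrow> spike n x y i ! j = (if j = i then y else x)"
  by (simp add: spike_def nth_list_update)

lemma map_spike: "map f (spike n x y i) = spike n (f x) (f y) i"
  by (simp add: spike_def map_update)

lemma set_spike:
  assumes "2 \<le> n" "i < n"
  shows "set (spike n x y i) = {x, y}"
proof -
  define j where "j = (if i = 0 then 1 else 0 :: nat)"
  have j: "j < n" "j \<noteq> i" using assms by (auto simp: j_def)
  have "x \<in> set (spike n x y i)"
    using j by (metis length_spike nth_mem nth_spike)
  moreover have "y \<in> set (spike n x y i)"
    using assms by (metis length_spike nth_mem nth_spike)
  moreover have "set (spike n x y i) \<subseteq> {x, y}"
    by (auto simp: in_set_conv_nth nth_spike)
  ultimately show ?thesis by blast
qed

lemma third_index:
  assumes "3 \<le> (n::nat)"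
  obtains l where "l < n" "l \<noteq> i" "l \<noteq> j"
proof -
  have "\<exists>l\<in>{0, 1, 2}. l \<noteq> i \<and> l \<noteq> j" by auto
  then obtain l where "l \<in> {0, 1, 2}" "l \<noteq> i" "l \<noteq> j" by blast
  with assms that[of l] show ?thesis by auto
qed

text \<open>A third coordinate, different from \<open>i\<close> and \<open>j\<close>, carries the
  majority value of both tuples. The positions need not agree, since \<open>x = y\<close> makes the
  tuple constant.\<close>

lemma spike_inject:
  assumes "3 \<le> n" "i < n" "j < n" "spike n x y i = spike n u v j"
  shows "x = u \<and> y = v"
proof -
  obtain l where l: "l < n" "l \<noteq> i" "l \<noteq> j" using third_index[OF assms(1)] .
  have eq: "spike n x y i ! m = spike n u v j ! m" for m using assms(4) by simp
  from eq[of l] l have "x = u" by (simp add: nth_spike)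
  with eq[of i] eq[of j] assms show ?thesis by (auto simp: nth_spike split: if_splits)
qed

text \<open>The choice \<open>x = y\<close> is allowed, so nonempty constant tuples count as spikes;
  \<open>wnu_op\<close> treats them before \<open>canon\<close> is applied.\<close>

definition is_spike :: "'b list \<Rightarrow> bool" where
  "is_spike xs \<longleftrightarrow> (\<exists>x y i. i < length xs \<and> xs = spike (length xs) x y i)"

text \<open>The near-constant tuples that the identities identify are all represented by the one whose
  exceptional entry comes first. The description is meaningful only for length at least 3.\<close>

definition canon :: "'b list \<Rightarrow> 'b list" where
  "canon xs = (if is_spike xs
     then (THE zs. \<exists>x y i. i < length xs \<and> xs = spike (length xs) x y i \<and> zs = spike (length xs) x y 0)
     else xs)"

lemma canon_spike:
  assumes "3 \<le> n" "i < n"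
  shows "canon (spike n x y i) = spike n x y 0"
proof -
  have "is_spike (spike n x y i)" using assms by (auto simp: is_spike_def)
  then show ?thesis
    unfolding canon_def using assms
    by (auto intro!: the_equality dest: spike_inject)
qed

lemma canon_cases:
  assumes "3 \<le> length xs"
  obtains x y i where "i < length xs" "xs = spike (length xs) x y i"
      "canon xs = spike (length xs) x y 0"
  | "\<not> is_spike xs" "canon xs = xs"
proof (cases "is_spike xs")
  case True
  then obtain x y i where i: "i < length xs" "xs = spike (length xs) x y i"
    by (auto simp: is_spike_def)
  with canon_spike[OF assms i(1), of x y] that(1)[OF i] show ?thesis by simp
qed (use that(2) in \<open>simp add: canon_def\<close>)

lemma set_canon:
  assumes "3 \<le> length xs"
  shows "set (canon xs) = set xs"
proof (rule canon_cases[OF assms])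
  fix x y i
  assume i: "i < length xs" "xs = spike (length xs) x y i" "canon xs = spike (length xs) x y 0"
  have "set (spike (length xs) x y j) = {x, y}" if "j < length xs" for j
    using assms that by (intro set_spike) auto
  from this[OF i(1)] this[of 0] have "set (spike (length xs) x y i) = set (spike (length xs) x y 0)"
    using i(1) by fastforce
  with i(2,3) show ?thesis by metis
qed simp

text \<open>Equal canonical spikes have the same majority value, which both tuples take at a third
  coordinate. Tuples that are not spikes are their own canonical forms, so they are equal; a mixed
  pair is impossible because a canonical spike is again a spike.\<close>

lemma canon_eq_imp_common_entry:
  assumes len: "3 \<le> length xs" "length ys = length xs" and eq: "canon xs = canon ys"
  shows "\<exists>j < length xs. xs ! j = ys ! j"
proof -
  have len': "3 \<le> length ys" using len by simp
  have sp: "is_spike (spike (length xs) x y 0)" for x y :: 'b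
    unfolding is_spike_def using len by (intro exI[of _ x] exI[of _ y] exI[of _ 0]) auto
  show ?thesis
  proof (rule canon_cases[OF len(1)])
    fix x y i
    assume xs: "xs = spike (length xs) x y i" "canon xs = spike (length xs) x y 0"
    show ?thesis
    proof (rule canon_cases[OF len'])
      fix u v j
      assume ys: "ys = spike (length ys) u v j" "canon ys = spike (length ys) u v 0"
      have "spike (length xs) x y 0 = spike (length xs) u v 0" using xs(2) ys(2) eq len by simp
      moreover have "0 < length xs" using len by linarith
      ultimately have "x = u" using spike_inject[OF len(1), of 0 0 x y u v] by simp
      moreover obtain l where "l < length xs" "l \<noteq> i" "l \<noteq> j" using third_index[OF len(1)] .
      ultimately show ?thesis using xs(1) ys(1) len(2) by (metis nth_spike)
    next
      assume "\<not> is_spike ys" "canon ys = ys"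
      then show ?thesis using sp[of x y] xs(2) eq by simp
    qed
  next
    assume xs: "\<not> is_spike xs" "canon xs = xs"
    show ?thesis
    proof (rule canon_cases[OF len'])
      fix u v
      assume "canon ys = spike (length ys) u v 0"
      then show ?thesis using sp[of u v] xs eq len(2) by simp
    next
      assume "canon ys = ys"
      then show ?thesis using xs eq len by (auto intro!: exI[of _ 0])
    qed
  qed
qed

text \<open>Constant tuples collapse by idempotence. The operation is total on
  \<open>wnu_term\<close>: the identities hold for arbitrary arguments, so terms need not be
  restricted to normal forms.\<close>

definition wnu_op :: "wnu_term list \<Rightarrow> wnu_term" where
  "wnu_op ts = (if ts = replicate (length ts) (hd ts) then hd ts else Node (canon ts))"

lemma wnu_op_replicate: "0 < n \<Longrightarrow> wnu_op (replicate n t) = t"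
  by (simp add: wnu_op_def)

lemma wnu_op_spike:
  assumes "3 \<le> n" "i < n" "j < n"
  shows "wnu_op (spike n x y i) = wnu_op (spike n x y j)"
proof (cases "x = y")
  case True
  then have "spike n x y l = replicate n x" for l
    by (simp add: list_eq_iff_nth_eq nth_spike)
  then show ?thesis by simp
next
  case False
  have "spike n x y l \<noteq> replicate n c" if "l < n" for l c
  proof
    assume "spike n x y l = replicate n c"
    then have "{x, y} \<subseteq> {c}" using set_spike[of n l x y] assms that by auto
    with False show False by auto
  qed
  then show ?thesis using assms by (simp add: wnu_op_def canon_spike)
qed

text \<open>A constant tuple collapses to its only entry, and \<open>canon\<close> keeps the set of
  entries of any other tuple.\<close>

lemma arg_subterm_wnu_op:
  assumes "3 \<le> length ts" "t \<in> set ts"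
  shows "t \<in> subterms (wnu_op ts)"
proof (cases "ts = replicate (length ts) (hd ts)")
  case True
  then have "t = hd ts" using assms(2) by (metis in_set_replicate)
  with True show ?thesis by (simp add: wnu_op_def)
next
  case False
  then show ?thesis using assms set_canon[OF assms(1)] subterms_refl[of t]
    by (auto simp: wnu_op_def simp del: subterms_refl)
qed

section \<open>Preservation of incomparability\<close>

definition incomparable :: "wnu_term \<Rightarrow> wnu_term \<Rightarrow> bool" where
  "incomparable a b \<longleftrightarrow> a \<notin> subterms b \<and> b \<notin> subterms a"

lemma wnu_op_not_subterm:
  assumes len: "3 \<le> length xs" "length ys = length xs"
    and inc: "\<And>i. i < length xs \<Longrightarrow> incomparable (xs ! i) (ys ! i)"
  shows "wnu_op xs \<notin> subterms (wnu_op ys)"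
proof
  assume sub: "wnu_op xs \<in> subterms (wnu_op ys)"
  have arg: "xs ! i \<in> subterms c" if "wnu_op xs \<in> subterms c" "i < length xs" for c i
    using arg_subterm_wnu_op[OF len(1)] that by (meson nth_mem subterms_trans)
  have 0: "0 < length xs" using len by linarith
  have hd: "zs ! 0 = wnu_op zs" if "zs = replicate (length zs) (hd zs)" "0 < length zs" for zs
    using that by (metis hd_conv_nth length_greater_0_conv wnu_op_def)
  show False
  \<comment> \<open>A constant \<open>ys\<close> yields the entry \<open>ys ! 0\<close>, which would
    then contain \<open>xs ! 0\<close>.\<close>
  proof (cases "ys = replicate (length ys) (hd ys)")
    case True
    then have "ys ! 0 = wnu_op ys" using 0 len by (intro hd) auto
    with arg[OF sub 0] inc[OF 0] show False by (simp add: incomparable_def)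
  next
    case False
    then have ys: "wnu_op ys = Node (canon ys)" by (simp add: wnu_op_def)
    have "set (canon ys) = set ys" using len by (simp add: set_canon)
    with sub ys consider "wnu_op xs = Node (canon ys)" | y where "y \<in> set ys" "wnu_op xs \<in> subterms y"
      by auto
    then show False
    proof cases
      case 1
      show False
      \<comment> \<open>The two values coincide. If \<open>xs\<close> is constant, the common value
        is \<open>xs ! 0\<close>, which contains \<open>ys ! 0\<close>; otherwise the canonical
        forms agree and force a common entry.\<close>
      proof (cases "xs = replicate (length xs) (hd xs)")
        case True
        then have "xs ! 0 = wnu_op xs" using 0 by (intro hd)
        moreover have "ys ! 0 \<in> subterms (wnu_op ys)"
          using len 0 arg_subterm_wnu_op[of ys "ys ! 0"] by simp
        ultimately show False using inc[OF 0] 1 ys by (simp add: incomparable_def)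
      next
        case False
        then have "canon xs = canon ys" using 1 by (simp add: wnu_op_def)
        then obtain j where "j < length xs" "xs ! j = ys ! j"
          using canon_eq_imp_common_entry[OF len] by blast
        then show False using inc[of j] by (simp add: incomparable_def)
      qed
    next
      case 2
      then obtain j where "j < length xs" "y = ys ! j" using len by (auto simp: in_set_conv_nth)
      with arg[OF 2(2)] inc show False by (auto simp: incomparable_def)
    qed
  qed
qed

lemma wnu_op_incomparable:
  assumes "3 \<le> length xs" "length ys = length xs"
    and "\<And>i. i < length xs \<Longrightarrow> incomparable (xs ! i) (ys ! i)"
  shows "incomparable (wnu_op xs) (wnu_op ys)"
proof -
  have "wnu_op xs \<notin> subterms (wnu_op ys)" using assms by (rule wnu_op_not_subterm)
  moreover have "wnu_op ys \<notin> subterms (wnu_op xs)"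
    by (rule wnu_op_not_subterm) (use assms in \<open>auto simp: incomparable_def\<close>)
  ultimately show ?thesis by (simp add: incomparable_def)
qed

section \<open>Clones and the term algebra\<close>

text \<open>The set \<open>S\<close> is a subpower of the algebra, its elements being functions from an arbitrary
  index type.\<close>

lemma clone_preserves:
  assumes basic: "\<And>n f cs. (n, f) \<in> basic_ops \<A> \<Longrightarrow> length cs = n \<Longrightarrow> set cs \<subseteq> S \<Longrightarrow>
      (\<lambda>j. f (map (\<lambda>c. c j) cs)) \<in> S"
    and base: "\<And>c j. c \<in> S \<Longrightarrow> c j \<in> base \<A>"
    and "(n, f) \<in> clone \<A>" "length cs = n" "set cs \<subseteq> S"
  shows "(\<lambda>j. f (map (\<lambda>c. c j) cs)) \<in> S"
  using assms(3-5)
proof (induction arbitrary: cs rule: clone.induct)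
  case (basic n f)
  then show ?case using assms(1) by blast
next
  case (proj i n)
  then have "map (\<lambda>c. c j) cs \<in> tuples (base \<A>) n" for j
    using base by (auto simp: tuples_def)
  then have "(\<lambda>j. projection (base \<A>) n i (map (\<lambda>c. c j) cs)) = cs ! i"
    using proj by (auto simp: projection_def)
  then show ?case using proj by auto
next
  case (comp m f gs n)
  then have tup: "map (\<lambda>c. c j) cs \<in> tuples (base \<A>) n" for j
    using base by (auto simp: tuples_def)
  \<comment> \<open>The inner operations, applied to \<open>cs\<close>, give new members of
    \<open>S\<close>, to which the hypothesis on the outer operation applies.\<close>
  define ds where "ds = map (\<lambda>g j. g (map (\<lambda>c. c j) cs)) gs"
  have "set ds \<subseteq> S" using comp by (auto simp: ds_def)
  moreover have "length ds = m" using comp by (simp add: ds_def)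
  ultimately have "(\<lambda>j. f (map (\<lambda>c. c j) ds)) \<in> S" using comp.IH(1) by blast
  moreover have "(\<lambda>j. compose_op (base \<A>) n f gs (map (\<lambda>c. c j) cs)) = (\<lambda>j. f (map (\<lambda>c. c j) ds))"
    using tup by (simp add: compose_op_def ds_def o_def)
  ultimately show ?case by simp
qed

text \<open>\<open>wnu_op\<close> is transported along \<open>h\<close>, which is meant to be
  injective, so that the algebra lives in the type that the variety is taken over.\<close>

definition term_algebra :: "(wnu_term \<Rightarrow> 'a) \<Rightarrow> nat \<Rightarrow> 'a algebra" where
  "term_algebra h k = \<lparr>base = range h,
     basic_ops = {(k, \<lambda>xs\<in>tuples (range h) k. h (wnu_op (map (inv h) xs)))}\<rparr>"

lemma tuples_range_map: "map h ts \<in> tuples (range h) (length ts)"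
  by (auto simp: tuples_def)

lemma term_algebra_in_wnu_variety:
  assumes "inj h" "3 \<le> k"
  shows "term_algebra h k \<in> wnu_variety k"
proof -
  define w where "w = (\<lambda>xs\<in>tuples (range h) k. h (wnu_op (map (inv h) xs)))"
  have w: "w (map h ts) = h (wnu_op ts)" if "length ts = k" for ts
    using tuples_range_map[of h ts] that assms(1) by (simp add: w_def o_def)
  have "holds (range h) (\<lambda>_. w) e" if "e \<in> set (wnu_identities (Op_Symbol 0 k))" for e
    unfolding holds_def
  proof (intro allI impI)
    fix v :: "nat \<Rightarrow> 'a"
    assume "range v \<subseteq> range h"
    then obtain a b where ab: "v 0 = h a" "v 1 = h b" by (meson imageE range_subsetD)
    from that have "e = (App (Op_Symbol 0 k) (replicate k (Var 0)), Var 0) \<or>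
        (\<exists>i. Suc i < k \<and> e = (App (Op_Symbol 0 k) (spike k (Var 0) (Var 1) i),
          App (Op_Symbol 0 k) (spike k (Var 0) (Var 1) (Suc i))))"
      unfolding spike_def by (force simp: wnu_identities_def Let_def less_diff_conv)
    then consider "e = (App (Op_Symbol 0 k) (replicate k (Var 0)), Var 0)"
      | i where "Suc i < k" "e = (App (Op_Symbol 0 k) (spike k (Var 0) (Var 1) i),
            App (Op_Symbol 0 k) (spike k (Var 0) (Var 1) (Suc i)))"
      by blast
    then show "eval_tm (\<lambda>_. w) v (fst e) = eval_tm (\<lambda>_. w) v (snd e)"
    proof cases
      case 1
      then show ?thesis using w[of "replicate k a"] ab assms
        by (simp add: wnu_op_replicate)
    next
      case (2 i)
      then show ?thesis
        using w[of "spike k a b i"] w[of "spike k a b (Suc i)"] ab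
          wnu_op_spike[OF assms(2), of i "Suc i" a b]
        by (simp add: map_spike)
    qed
  qed
  moreover have "is_algebra (term_algebra h k)"
    by (auto simp: is_algebra_def term_algebra_def operations_def)
  ultimately show ?thesis
    by (auto simp: wnu_variety_def term_algebra_def w_def)
qed

text \<open>Every singleton is a subalgebra, that is, a subpower with a one-element index
  type.\<close>

lemma clone_term_algebra_idem:
  assumes "inj h" "3 \<le> k" "(n, f) \<in> clone (term_algebra h k)"
  shows "f (replicate n (h t)) = h t"
proof -
  have "(\<lambda>j::unit. f (map (\<lambda>c. c j) (replicate n (\<lambda>_. h t)))) \<in> {\<lambda>_. h t}"
  proof (rule clone_preserves[OF _ _ assms(3)])
    fix m g and cs :: "(unit \<Rightarrow> 'a) list"
    assume g: "(m, g) \<in> basic_ops (term_algebra h k)" "length cs = m" "set cs \<subseteq> {\<lambda>_. h t}"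
    then have "cs = replicate k (\<lambda>_. h t)"
      by (auto simp: term_algebra_def intro!: replicate_eqI)
    then have "map (\<lambda>c. c j) cs = map h (replicate k t)" for j by simp
    then show "(\<lambda>j. g (map (\<lambda>c. c j) cs)) \<in> {\<lambda>_. h t}"
      using g assms tuples_range_map[of h "replicate k t"]
      by (auto simp: term_algebra_def wnu_op_replicate)
  qed (auto simp: term_algebra_def)
  then show ?thesis by (simp add: fun_eq_iff)
qed

text \<open>Incomparability is encoded as a subpower indexed by \<open>bool\<close>. The clone
  therefore preserves it, and it is irreflexive because every term is its own subterm.\<close>

lemma clone_term_algebra_incomparable:
  assumes "inj h" "3 \<le> k" "(n, f) \<in> clone (term_algebra h k)"
    and len: "length xs = n" "length ys = n"
    and inc: "\<And>i. i < n \<Longrightarrow> incomparable (xs ! i) (ys ! i)"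
  shows "f (map h xs) \<noteq> f (map h ys)"
proof -
  define S where "S = {\<lambda>j. h (if j then a else b) | a b. incomparable a b}"
  define cs where "cs = map (\<lambda>(a, b) j. h (if j then a else b)) (zip xs ys)"
  have "(\<lambda>j. f (map (\<lambda>c. c j) cs)) \<in> S"
  proof (rule clone_preserves[OF _ _ assms(3)])
    fix m g and ds :: "(bool \<Rightarrow> 'a) list"
    assume g: "(m, g) \<in> basic_ops (term_algebra h k)" "length ds = m" "set ds \<subseteq> S"
    \<comment> \<open>Members of \<open>S\<close> are functions; \<open>p\<close> recovers a pair of
      terms behind each of them.\<close>
    have "\<forall>d\<in>set ds. \<exists>p. d = (\<lambda>j. h (if j then fst p else snd p)) \<and> incomparable (fst p) (snd p)"
      using g(3) by (fastforce simp: S_def)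
    then obtain p where p: "\<And>d. d \<in> set ds \<Longrightarrow> d = (\<lambda>j. h (if j then fst (p d) else snd (p d)))"
        "\<And>d. d \<in> set ds \<Longrightarrow> incomparable (fst (p d)) (snd (p d))"
      by metis
    define us where "us = map (fst \<circ> p) ds"
    define vs where "vs = map (snd \<circ> p) ds"
    have [simp]: "length us = k" "length vs = k" "m = k"
      using g by (auto simp: us_def vs_def term_algebra_def)
    have "map (\<lambda>d. d j) ds = map h (if j then us else vs)" for j
    proof -
      have "d j = h (if j then fst (p d) else snd (p d))" if "d \<in> set ds" for d
        using fun_cong[OF p(1)[OF that]] .
      then show ?thesis by (cases j) (simp_all add: us_def vs_def)
    qed
    moreover have "g (map h ts) = h (wnu_op ts)" if "length ts = k" for ts
      using g(1) tuples_range_map[of h ts] that assms(1) by (auto simp: term_algebra_def o_def)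
    ultimately have "(\<lambda>j. g (map (\<lambda>d. d j) ds)) = (\<lambda>j. h (if j then wnu_op us else wnu_op vs))"
      by auto
    moreover have "incomparable (wnu_op us) (wnu_op vs)"
      using assms(2) p(2) g(2) by (intro wnu_op_incomparable) (auto simp: us_def vs_def)
    ultimately show "(\<lambda>j. g (map (\<lambda>d. d j) ds)) \<in> S" by (auto simp: S_def)
  next
    show "set cs \<subseteq> S"
      using inc len by (fastforce simp: cs_def S_def set_zip)
  qed (use len in \<open>auto simp: S_def cs_def term_algebra_def\<close>)
  then obtain a b where ab: "incomparable a b"
      "(\<lambda>j. f (map (\<lambda>c. c j) cs)) = (\<lambda>j. h (if j then a else b))"
    by (auto simp: S_def)
  moreover have "map (\<lambda>c. c True) cs = map h xs" "map (\<lambda>c. c False) cs = map h ys"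
    using len by (auto simp: cs_def list_eq_iff_nth_eq)
  ultimately have "f (map h xs) = h a" "f (map h ys) = h b"
    using fun_cong[OF ab(2), of True] fun_cong[OF ab(2), of False] by simp_all
  then show ?thesis using assms(1) ab(1) by (auto simp: incomparable_def dest: injD)
qed

section \<open>Linear identities and triviality\<close>

fun tm_vars :: "tm \<Rightarrow> nat set" where
  "tm_vars (Var x) = {x}"
| "tm_vars (App f ts) = (\<Union>t\<in>set ts. tm_vars t)"

lemma linear_tm_App:
  "linear_tm (App f ts) \<Longrightarrow> \<exists>xs. ts = map Var xs"
  by (metis ex_map_conv linear_tm.simps(2) subsetD rangeE)

lemma eval_linear_tm_const:
  assumes "linear_tm t" "wf_tm t" "\<And>x. x \<in> tm_vars t \<Longrightarrow> v x = a"
    and "\<And>f. f \<in> symbols t \<Longrightarrow> I f (replicate (arity f) a) = a"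
  shows "eval_tm I v t = a"
proof (cases t)
  case (App f ts)
  then obtain xs where xs: "ts = map Var xs" using assms(1) linear_tm_App by blast
  then have "map (eval_tm I v) ts = replicate (arity f) a"
    using App assms(2,3) by (auto intro!: replicate_eqI)
  with App assms(4) show ?thesis by simp
qed (use assms in auto)

text \<open>Interpreting every symbol \<open>f\<close> by its projection to coordinate \<open>p f\<close>, a linear term evaluates
  to the variable in that place.\<close>

fun selected_var :: "(op_symbol \<Rightarrow> nat) \<Rightarrow> tm \<Rightarrow> tm" where
  "selected_var p (Var x) = Var x"
| "selected_var p (App f ts) = ts ! p f"

lemma trivial_condition_if_selected_var_eq:
  assumes "slemc [(s, t)]" "\<And>f. f \<in> symbols s \<union> symbols t \<Longrightarrow> p f < arity f"
    and "selected_var p s = selected_var p t"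
  shows "trivial_condition [(s, t)]"
proof -
  define I where "I f = projection {0, 1 :: nat} (arity f) (p f)" for f
  have "eval_tm I v u = eval_tm I v (selected_var p u)"
    if v: "range v \<subseteq> {0, 1}" and u: "u \<in> {s, t}" for v u
  proof (cases u)
    case (App f ts)
    then obtain xs where xs: "ts = map Var xs"
      using assms(1) u linear_tm_App by (fastforce simp: slemc_def linear_condition_def)
    have "length ts = arity f" "p f < arity f"
      using App u assms(1,2) by (auto simp: slemc_def maltsev_condition_def)
    moreover from this have "map v xs \<in> tuples {0, 1} (arity f)"
      using v xs image_mono[OF subset_UNIV, of v "set xs"] by (auto simp: tuples_def)
    ultimately show ?thesis using App xs by (simp add: I_def projection_def o_def)
  qed simp
  then have "holds {0, 1} I (s, t)"
    using assms(3) by (auto simp: holds_def)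
  moreover have "(arity f, I f) \<in> clone projection_algebra" if "f \<in> symbols s \<union> symbols t" for f
    using clone.proj[of "p f" "arity f" projection_algebra] assms(2)[OF that]
    by (simp add: I_def projection_algebra_def)
  ultimately show ?thesis
    by (auto simp: trivial_condition_def satisfies_def condition_symbols_def projection_algebra_def)
qed

text \<open>Disjoint symbols can be interpreted by independent projections, each chosen to select an
  occurrence of \<open>x\<close>.\<close>

lemma trivial_condition_if_common_var:
  assumes "slemc [(s, t)]" "x \<in> tm_vars s" "x \<in> tm_vars t" "symbols s \<inter> symbols t = {}"
  shows "trivial_condition [(s, t)]"
proof -
  have pos: "\<exists>i. (\<forall>f\<in>symbols u. i < arity f) \<and> selected_var (\<lambda>_. i) u = Var x"
    if u: "linear_tm u" "wf_tm u" "x \<in> tm_vars u" for u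
  proof (cases u)
    case (App f ts)
    then obtain xs where xs: "ts = map Var xs" using u(1) linear_tm_App by blast
    with App u(3) obtain i where "i < length xs" "xs ! i = x" by (auto simp: in_set_conv_nth)
    then show ?thesis using App xs u(2) by auto
  qed (use u in auto)
  from assms(1) have "linear_tm s" "wf_tm s" "linear_tm t" "wf_tm t"
    by (auto simp: slemc_def linear_condition_def maltsev_condition_def)
  with pos assms(2,3) obtain i j where i: "(\<forall>f\<in>symbols s. i < arity f) \<and> selected_var (\<lambda>_. i) s = Var x"
    and j: "(\<forall>f\<in>symbols t. j < arity f) \<and> selected_var (\<lambda>_. j) t = Var x"
    by meson
  define p where "p f = (if f \<in> symbols s then i else j)" for f
  have "selected_var p s = Var x" using i assms(2) by (cases s) (auto simp: p_def)
  moreover have "selected_var p t = Var x"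
    using j assms(3,4) by (cases t) (auto simp: p_def)
  ultimately show ?thesis
    using i j by (intro trivial_condition_if_selected_var_eq[OF assms(1), of p]) (auto simp: p_def)
qed

text \<open>A linear term contains at most one operation symbol, its head, so a shared symbol heads
  both sides.\<close>

lemma slemc_same_symbol_cases:
  assumes "slemc [(s, t)]" "symbols s \<inter> symbols t \<noteq> {}"
  obtains f xs ys where "s = App f (map Var xs)" "t = App f (map Var ys)"
    "length xs = arity f" "length ys = arity f"
proof -
  have lin: "linear_tm s" "wf_tm s" "linear_tm t" "wf_tm t"
    using assms(1) by (auto simp: slemc_def linear_condition_def maltsev_condition_def)
  obtain f ts where s: "s = App f ts" using assms(2) by (cases s) auto
  obtain g us where t: "t = App g us" using assms(2) by (cases t) auto
  obtain xs ys where "ts = map Var xs" "us = map Var ys"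
    using lin s t linear_tm_App by metis
  with that[of f xs ys] lin s t assms(2) show ?thesis by auto
qed

section \<open>Failure of nontrivial identities in the term algebra\<close>

theorem theorem8:
  fixes k :: nat
  assumes "k \<ge> 3"
    and "infinite (UNIV :: 'a set)"
  shows "\<not> (\<exists>M. slemc M \<and> \<not> trivial_condition M \<and>
    class_satisfies (wnu_variety k :: 'a algebra set) M)"
proof
  assume "\<exists>M. slemc M \<and> \<not> trivial_condition M \<and>
    class_satisfies (wnu_variety k :: 'a algebra set) M"
  then obtain M where M: "slemc M" "\<not> trivial_condition M"
    "class_satisfies (wnu_variety k :: 'a algebra set) M" by blast
  then obtain s t where st: "M = [(s, t)]"
    by (auto simp: slemc_def length_Suc_conv)
  have lin: "linear_tm s" "wf_tm s" "linear_tm t" "wf_tm t"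
    using M(1) st by (auto simp: slemc_def linear_condition_def maltsev_condition_def)
  obtain e :: "nat \<Rightarrow> 'a" where "inj e"
    using infinite_countable_subset[OF assms(2)] by blast
  \<comment> \<open>Terms are countable, so they embed into any infinite type.\<close>
  define h :: "wnu_term \<Rightarrow> 'a" where "h = e \<circ> to_nat"
  have h: "inj h" using \<open>inj e\<close> by (simp add: h_def inj_compose)
  obtain I where I: "\<And>f. f \<in> symbols s \<union> symbols t \<Longrightarrow> (arity f, I f) \<in> clone (term_algebra h k)"
    and hol: "holds (range h) I (s, t)"
    using M(3) st term_algebra_in_wnu_variety[OF h assms(1)]
    by (fastforce simp: class_satisfies_def satisfies_def condition_symbols_def term_algebra_def)
  have ev: "eval_tm I v s = eval_tm I v t" if "range v \<subseteq> range h" for v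
    using hol that by (simp add: holds_def)
  show False
  proof (cases "symbols s \<inter> symbols t = {}")
    case True
    have "tm_vars s \<inter> tm_vars t \<noteq> {}"
    proof
      assume disj: "tm_vars s \<inter> tm_vars t = {}"
      \<comment> \<open>If no variable is shared, each side sees a single value, and idempotence
        evaluates the sides to two different generators.\<close>
      define v where "v x = h (Gen (if x \<in> tm_vars s then 0 else 1))" for x
      have idem: "I f (replicate (arity f) (h a)) = h a" if "f \<in> symbols s \<union> symbols t" for f a
        using clone_term_algebra_idem[OF h assms(1) I[OF that]] .
      have "eval_tm I v s = h (Gen 0)"
        using lin idem by (intro eval_linear_tm_const) (auto simp: v_def)
      moreover have "eval_tm I v t = h (Gen 1)"
        using lin idem disj by (intro eval_linear_tm_const) (auto simp: v_def)
      moreover have "range v \<subseteq> range h" by (auto simp: v_def)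
      ultimately show False using ev h by (auto dest: injD)
    qed
    then show False using trivial_condition_if_common_var M(1,2) st True by blast
  next
    case False
    then obtain f xs ys where fxy: "s = App f (map Var xs)" "t = App f (map Var ys)"
      "length xs = arity f" "length ys = arity f"
      using slemc_same_symbol_cases M(1) st by metis
    \<comment> \<open>A common entry at \<open>i\<close> would let projection to coordinate
      \<open>i\<close> satisfy the identity.\<close>
    have "xs ! i \<noteq> ys ! i" if "i < arity f" for i
      using trivial_condition_if_selected_var_eq[of s t "\<lambda>_. i"] M(1,2) st fxy that by auto
    then have "incomparable (map Gen xs ! i) (map Gen ys ! i)" if "i < arity f" for i
      using fxy that by (simp add: incomparable_def eq_commute)
    then have "I f (map h (map Gen xs)) \<noteq> I f (map h (map Gen ys))"
      using fxy by (intro clone_term_algebra_incomparable[OF h assms(1) I]) auto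
    \<comment> \<open>The identity is evaluated with each variable sent to its own
      generator.\<close>
    moreover have "I f (map h (map Gen xs)) = I f (map h (map Gen ys))"
      using ev[of "h \<circ> Gen"] fxy by (auto simp: o_def)
    ultimately show False by simp
  qed
qed

end
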